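(* Let $d\ge2$ and let $\Omega\subset\mathbb{R}^d$ be an open, bounded, connected set containing the origin. There is a constant $C>0$ (depending only on $\Omega$) such that, for all $h>0$, all $k\ge1$ and any $i_1,\dots,i_k\in\{1,\dots,d\}$, for any $x\in\Omega$ with $d(x,\partial\Omega)\ge4kh$ and any $r\in(2kh,\frac12d(x,\partial\Omega))$, $$\big|D^{(h)}_{i_1,\dots,i_k}\varphi_1(x)\big|\le\Big(\frac{Ck}{r}\Big)^k\sup_{w\in B(x,r)}|\varphi_1(w)|.$$
   Context: $\varphi_1$ is the first eigenfunction of the Dirichlet Laplacian on $\Omega$ ($-\Delta\varphi_1=\mu_1\varphi_1$ in $\Omega$, $\varphi_1=0$ on $\partial\Omega$, $\mu_1$ the smallest eigenvalue), chosen positive and normalised by $\int_\Omega\varphi_1^2=1$. $d(x,\partial\Omega)$ is the Euclidean distance and $B(x,r)$ the Euclidean ball in $\mathbb{R}^d$. For $h>0$, with $e_i$ the canonical basis vectors, $$D^{(h)}_{i_1,\dots,i_k}\psi(x)=\frac1{(2h)^k}\sum_{\beta\in\{+1,-1\}^k}\mathrm{sign}(\beta)\,\psi\Big(x+h\sum_{j=1}^k\beta_je_{i_j}\Big),\qquad\mathrm{sign}(\beta)=\prod_{j=1}^k\beta_j .$$ *)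

theory Defs
  imports "HOL-Analysis.Analysis"
begin

definition partial_deriv :: "'d::finite \<Rightarrow> (real^'d \<Rightarrow> real) \<Rightarrow> real^'d \<Rightarrow> real" where
  "partial_deriv i f x = frechet_derivative f (at x) (axis i 1)"

definition gradient :: "(real^'d::finite \<Rightarrow> real) \<Rightarrow> real^'d \<Rightarrow> real^'d" where
  "gradient f x = (\<chi> i. partial_deriv i f x)"

definition laplacian :: "(real^'d::finite \<Rightarrow> real) \<Rightarrow> real^'d \<Rightarrow> real" where
  "laplacian f x = (\<Sum>i\<in>UNIV. partial_deriv i (partial_deriv i f) x)"

text \<open>\<open>C_on n S f\<close>: \<open>f\<close> is \<open>n\<close> times continuously differentiable on the open set \<open>S\<close>.\<close>

primrec C_on :: "nat \<Rightarrow> (real^'d::finite) set \<Rightarrow> (real^'d \<Rightarrow> real) \<Rightarrow> bool" where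
  "C_on 0 S f \<longleftrightarrow> continuous_on S f"
| "C_on (Suc n) S f \<longleftrightarrow> (\<forall>x\<in>S. f differentiable (at x)) \<and> (\<forall>i. C_on n S (partial_deriv i f))"

definition test_function :: "(real^'d::finite) set \<Rightarrow> (real^'d \<Rightarrow> real) \<Rightarrow> bool" where
  "test_function \<Omega> \<psi> \<longleftrightarrow> (\<forall>n. C_on n UNIV \<psi>) \<and>
     compact (closure {x. \<psi> x \<noteq> 0}) \<and> closure {x. \<psi> x \<noteq> 0} \<subseteq> \<Omega>"

definition square_integrable_on ::
    "(real^'d::finite) set \<Rightarrow> (real^'d \<Rightarrow> 'b::euclidean_space) \<Rightarrow> bool" where
  "square_integrable_on \<Omega> f \<longleftrightarrow> f \<in> borel_measurable (lebesgue_on \<Omega>) \<and>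
     integrable (lebesgue_on \<Omega>) (\<lambda>x. (norm (f x))\<^sup>2)"

text \<open>The Sobolev space \<open>H\<^sub>0\<^sup>1(\<Omega>)\<close>, i.e. the closure of the test functions in \<open>H\<^sup>1(\<Omega>)\<close>; the
  \<open>L\<^sup>2\<close> limit \<open>g\<close> of the gradients is the weak gradient of \<open>u\<close>.\<close>

definition in_H10 :: "(real^'d::finite) set \<Rightarrow> (real^'d \<Rightarrow> real) \<Rightarrow> bool" where
  "in_H10 \<Omega> u \<longleftrightarrow> square_integrable_on \<Omega> u \<and>
     (\<exists>g \<psi>. square_integrable_on \<Omega> g \<and> (\<forall>n. test_function \<Omega> (\<psi> n)) \<and>
        (\<lambda>n::nat. integral\<^sup>L (lebesgue_on \<Omega>) (\<lambda>x. (\<psi> n x - u x)\<^sup>2)) \<longlonglongrightarrow> 0 \<and>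
        (\<lambda>n. integral\<^sup>L (lebesgue_on \<Omega>) (\<lambda>x. (norm (gradient (\<psi> n) x - g x))\<^sup>2)) \<longlonglongrightarrow> 0)"

text \<open>The boundary is arbitrary, so the condition \<open>u = 0\<close> on \<open>\<partial>\<Omega>\<close> is understood in the
  \<open>H\<^sub>0\<^sup>1\<close> sense. By interior elliptic regularity every weak eigenfunction has a (unique)
  representative that is smooth in \<open>\<Omega>\<close>; this representative is meant, and it satisfies the
  equation pointwise. Values outside \<open>\<Omega>\<close> are irrelevant.\<close>

definition dirichlet_eigenfunction ::
    "(real^'d::finite) set \<Rightarrow> real \<Rightarrow> (real^'d \<Rightarrow> real) \<Rightarrow> bool" where
  "dirichlet_eigenfunction \<Omega> \<mu> u \<longleftrightarrow>
     C_on 2 \<Omega> u \<and> (\<forall>x\<in>\<Omega>. - laplacian u x = \<mu> * u x) \<and> in_H10 \<Omega> u \<and> (\<exists>x\<in>\<Omega>. u x \<noteq> 0)"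

definition dirichlet_eigenvalue :: "(real^'d::finite) set \<Rightarrow> real \<Rightarrow> bool" where
  "dirichlet_eigenvalue \<Omega> \<mu> \<longleftrightarrow> (\<exists>u. dirichlet_eigenfunction \<Omega> \<mu> u)"

definition first_dirichlet_eigenvalue :: "(real^'d::finite) set \<Rightarrow> real \<Rightarrow> bool" where
  "first_dirichlet_eigenvalue \<Omega> \<mu> \<longleftrightarrow>
     dirichlet_eigenvalue \<Omega> \<mu> \<and> (\<forall>\<nu>. dirichlet_eigenvalue \<Omega> \<nu> \<longrightarrow> \<mu> \<le> \<nu>)"

definition first_dirichlet_eigenfunction ::
    "(real^'d::finite) set \<Rightarrow> (real^'d \<Rightarrow> real) \<Rightarrow> bool" where
  "first_dirichlet_eigenfunction \<Omega> \<phi> \<longleftrightarrow>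
     (\<exists>\<mu>. first_dirichlet_eigenvalue \<Omega> \<mu> \<and> dirichlet_eigenfunction \<Omega> \<mu> \<phi>) \<and>
     (\<forall>x\<in>\<Omega>. \<phi> x > 0) \<and> integral\<^sup>L (lebesgue_on \<Omega>) (\<lambda>x. (\<phi> x)\<^sup>2) = 1"

text \<open>Index tuples \<open>(i\<^sub>1,\<dots>,i\<^sub>k)\<close> are given by the values of \<open>i :: nat \<Rightarrow> 'd\<close> on \<open>{..<k}\<close>, and
  \<open>{+1,-1}\<^sup>k\<close> is the set of functions from \<open>{..<k}\<close> to \<open>{1,-1}\<close>.\<close>

definition discrete_deriv ::
    "real \<Rightarrow> nat \<Rightarrow> (nat \<Rightarrow> 'd::finite) \<Rightarrow> (real^'d \<Rightarrow> real) \<Rightarrow> real^'d \<Rightarrow> real" where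
  "discrete_deriv h k i \<psi> x =
     1 / (2 * h) ^ k *
       (\<Sum>\<beta>\<in>{..<k} \<rightarrow>\<^sub>E {1, -1 :: real}.
          (\<Prod>j<k. \<beta> j) * \<psi> (x + h *\<^sub>R (\<Sum>j<k. \<beta> j *\<^sub>R axis (i j) 1)))"

end

theory Submission
  imports Defs
begin

text \<open>The discrete derivative is a \<open>k\<close>-fold composition of central difference quotients, each of which
  preserves the equation \<open>\<Delta>u = -\<mu> u\<close> on a slightly smaller ball. So it is enough to lose a factor
  \<open>C / \<rho>\<close> with \<open>\<rho> = r / k > 2 h\<close> and a distance \<open>\<rho>\<close> in each step. This one-step estimate is the
  interior gradient bound of Gilbarg and Trudinger (Section 3.4): the odd part of \<open>u\<close> under
  reflection in a coordinate hyperplane is compared on a half cube with an explicit quadratic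
  barrier, by the maximum principle. The constant depends on \<open>\<Omega>\<close> only through the first
  eigenvalue, which \<open>\<Omega>\<close> determines, and a bound on the size of \<open>\<Omega>\<close>.\<close>

section \<open>Laplacians along the coordinate axes\<close>

text \<open>Only derivatives along the axes enter: \<open>g i\<close> and \<open>g' i\<close> play
  the role of first and second partial derivatives, and the Laplacian \<open>L\<close> is a
  parameter. In this form the notion is visibly stable under linear combinations, translations and
  reflections, the operations that build odd parts and difference quotients.\<close>

definition has_laplacian_on ::
    "(real^'d::finite \<Rightarrow> real) \<Rightarrow> (real^'d \<Rightarrow> real) \<Rightarrow> (real^'d) set \<Rightarrow> bool" where
  "has_laplacian_on u L S \<longleftrightarrow> continuous_on S u \<and>
     (\<exists>g g'. \<forall>y\<in>S. (\<Sum>i\<in>UNIV. g' i y) = L y \<and>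
       (\<forall>i. ((\<lambda>t. u (y + t *\<^sub>R axis i 1)) has_real_derivative g i y) (at 0) \<and>
            ((\<lambda>t. g i (y + t *\<^sub>R axis i 1)) has_real_derivative g' i y) (at 0)))"

lemma has_laplacian_onI:
  assumes "continuous_on S u"
    and "\<And>y. y \<in> S \<Longrightarrow> (\<Sum>i\<in>UNIV. g' i y) = L y"
    and "\<And>y i. y \<in> S \<Longrightarrow> ((\<lambda>t. u (y + t *\<^sub>R axis i 1)) has_real_derivative g i y) (at 0)"
    and "\<And>y i. y \<in> S \<Longrightarrow> ((\<lambda>t. g i (y + t *\<^sub>R axis i 1)) has_real_derivative g' i y) (at 0)"
  shows "has_laplacian_on u L S"
  unfolding has_laplacian_on_def using assms by blast

lemma has_laplacian_onE:
  assumes "has_laplacian_on u L S"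
  obtains g g' where "continuous_on S u"
    and "\<And>y. y \<in> S \<Longrightarrow> (\<Sum>i\<in>UNIV. g' i y) = L y"
    and "\<And>y i. y \<in> S \<Longrightarrow> ((\<lambda>t. u (y + t *\<^sub>R axis i 1)) has_real_derivative g i y) (at 0)"
    and "\<And>y i. y \<in> S \<Longrightarrow> ((\<lambda>t. g i (y + t *\<^sub>R axis i 1)) has_real_derivative g' i y) (at 0)"
  using assms unfolding has_laplacian_on_def by blast

lemma has_laplacian_on_subset:
  "has_laplacian_on u L S \<Longrightarrow> T \<subseteq> S \<Longrightarrow> has_laplacian_on u L T"
  unfolding has_laplacian_on_def by (meson continuous_on_subset subsetD)

lemma has_laplacian_on_add:
  assumes "has_laplacian_on u L S" "has_laplacian_on v L' S"
  shows "has_laplacian_on (\<lambda>x. u x + v x) (\<lambda>x. L x + L' x) S"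
proof -
  from assms(1) obtain g g' where u: "continuous_on S u"
    "\<And>y. y \<in> S \<Longrightarrow> (\<Sum>i\<in>UNIV. g' i y) = L y"
    "\<And>y i. y \<in> S \<Longrightarrow> ((\<lambda>t. u (y + t *\<^sub>R axis i 1)) has_real_derivative g i y) (at 0)"
    "\<And>y i. y \<in> S \<Longrightarrow> ((\<lambda>t. g i (y + t *\<^sub>R axis i 1)) has_real_derivative g' i y) (at 0)"
    by (rule has_laplacian_onE) blast
  from assms(2) obtain f f' where v: "continuous_on S v"
    "\<And>y. y \<in> S \<Longrightarrow> (\<Sum>i\<in>UNIV. f' i y) = L' y"
    "\<And>y i. y \<in> S \<Longrightarrow> ((\<lambda>t. v (y + t *\<^sub>R axis i 1)) has_real_derivative f i y) (at 0)"
    "\<And>y i. y \<in> S \<Longrightarrow> ((\<lambda>t. f i (y + t *\<^sub>R axis i 1)) has_real_derivative f' i y) (at 0)"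
    by (rule has_laplacian_onE) blast
  show ?thesis
    by (rule has_laplacian_onI[where g="\<lambda>i y. g i y + f i y" and g'="\<lambda>i y. g' i y + f' i y"])
       (auto intro!: continuous_intros DERIV_add simp: sum.distrib u v)
qed

lemma has_laplacian_on_cmult:
  assumes "has_laplacian_on u L S"
  shows "has_laplacian_on (\<lambda>x. c * u x) (\<lambda>x. c * L x) S"
proof -
  from assms(1) obtain g g' where u: "continuous_on S u"
    "\<And>y. y \<in> S \<Longrightarrow> (\<Sum>i\<in>UNIV. g' i y) = L y"
    "\<And>y i. y \<in> S \<Longrightarrow> ((\<lambda>t. u (y + t *\<^sub>R axis i 1)) has_real_derivative g i y) (at 0)"
    "\<And>y i. y \<in> S \<Longrightarrow> ((\<lambda>t. g i (y + t *\<^sub>R axis i 1)) has_real_derivative g' i y) (at 0)"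
    by (rule has_laplacian_onE) blast
  show ?thesis
    by (rule has_laplacian_onI[where g="\<lambda>i y. c * g i y" and g'="\<lambda>i y. c * g' i y"])
       (auto intro!: continuous_intros DERIV_cmult simp: sum_distrib_left[symmetric] u)
qed

lemma has_laplacian_on_translate:
  assumes "has_laplacian_on u L S"
  shows "has_laplacian_on (\<lambda>x. u (a + x)) (\<lambda>x. L (a + x)) {x. a + x \<in> S}"
proof -
  from assms(1) obtain g g' where u: "continuous_on S u"
    "\<And>y. y \<in> S \<Longrightarrow> (\<Sum>i\<in>UNIV. g' i y) = L y"
    "\<And>y i. y \<in> S \<Longrightarrow> ((\<lambda>t. u (y + t *\<^sub>R axis i 1)) has_real_derivative g i y) (at 0)"
    "\<And>y i. y \<in> S \<Longrightarrow> ((\<lambda>t. g i (y + t *\<^sub>R axis i 1)) has_real_derivative g' i y) (at 0)"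
    by (rule has_laplacian_onE) blast
  show ?thesis
  proof (rule has_laplacian_onI[where g="\<lambda>i y. g i (a + y)" and g'="\<lambda>i y. g' i (a + y)"])
    show "continuous_on {x. a + x \<in> S} (\<lambda>x. u (a + x))"
      by (rule continuous_on_compose2[OF u(1)]) (auto intro!: continuous_intros)
  qed (use u(2) u(3,4)[of "a + _"] in \<open>simp_all add: add.assoc\<close>)
qed

section \<open>Reflection in a coordinate hyperplane\<close>

definition reflect :: "'d \<Rightarrow> real^'d::finite \<Rightarrow> real^'d" where
  "reflect i z = z - (2 * z $ i) *\<^sub>R axis i 1"

lemma reflect_nth: "reflect i z $ j = (if j = i then - (z $ j) else z $ j)"
  by (simp add: reflect_def axis_def)

lemma reflect_add_axis:
  "reflect i (z + t *\<^sub>R axis j 1) = reflect i z + ((if j = i then -1 else 1) * t) *\<^sub>R axis j 1"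
  by (simp add: vec_eq_iff reflect_nth) (auto simp: axis_def)

text \<open>The \<open>i\<close>-th first derivative changes sign under the reflection and the
  second differentiation changes it back: the sign \<open>s j\<close> squares to 1.\<close>

lemma has_laplacian_on_reflect:
  assumes "has_laplacian_on u L S"
  shows "has_laplacian_on (\<lambda>x. u (reflect i x)) (\<lambda>x. L (reflect i x)) {x. reflect i x \<in> S}"
proof -
  from assms(1) obtain g g' where u: "continuous_on S u"
    "\<And>y. y \<in> S \<Longrightarrow> (\<Sum>i\<in>UNIV. g' i y) = L y"
    "\<And>y i. y \<in> S \<Longrightarrow> ((\<lambda>t. u (y + t *\<^sub>R axis i 1)) has_real_derivative g i y) (at 0)"
    "\<And>y i. y \<in> S \<Longrightarrow> ((\<lambda>t. g i (y + t *\<^sub>R axis i 1)) has_real_derivative g' i y) (at 0)"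
    by (rule has_laplacian_onE) blast
  define s :: "'a \<Rightarrow> real" where "s j = (if j = i then -1 else 1)" for j
  have ss: "s j * s j = 1" for j by (simp add: s_def)
  have flip: "((\<lambda>t. f (s j * t)) has_real_derivative s j * D) (at 0)"
    if "(f has_real_derivative D) (at 0)" for f :: "real \<Rightarrow> real" and D j
    using DERIV_chain2[of f D "\<lambda>t. s j * t" 0 "s j" UNIV, OF _ DERIV_cmult_Id] that
    by (simp add: mult.commute)
  show ?thesis
  proof (rule has_laplacian_onI[where g="\<lambda>j y. s j * g j (reflect i y)"
        and g'="\<lambda>j y. g' j (reflect i y)"])
    show "continuous_on {x. reflect i x \<in> S} (\<lambda>x. u (reflect i x))"
      by (rule continuous_on_compose2[OF u(1)]) (auto simp: reflect_def intro!: continuous_intros)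
  next
    fix y j assume y: "y \<in> {x. reflect i x \<in> S}"
    show "((\<lambda>t. u (reflect i (y + t *\<^sub>R axis j 1))) has_real_derivative s j * g j (reflect i y)) (at 0)"
      unfolding reflect_add_axis s_def[symmetric] using y by (auto intro!: flip[of "\<lambda>t. u (reflect i y + t *\<^sub>R axis j 1)"] u(3))
    show "((\<lambda>t. s j * g j (reflect i (y + t *\<^sub>R axis j 1))) has_real_derivative g' j (reflect i y)) (at 0)"
      unfolding reflect_add_axis s_def[symmetric]
      using DERIV_cmult[OF flip[OF u(4)[of "reflect i y" j], of j], of "s j"] y
      by (simp add: mult.assoc[symmetric] ss)
  qed (use u(2) in auto)
qed

text \<open>By the chain rule a Frechet derivative restricts to the derivative along each axis; this
  is applied to \<open>u\<close> and then to its first partial derivatives.\<close>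

lemma C_on_2_has_laplacian_on:
  assumes "C_on 2 S u"
  shows "has_laplacian_on u (laplacian u) S"
proof -
  have *: "((\<lambda>t. f (y + t *\<^sub>R axis i 1)) has_real_derivative partial_deriv i f y) (at 0)"
    if "f differentiable (at y)" for f :: "real^'a \<Rightarrow> real" and y i
  proof -
    have "(f has_derivative frechet_derivative f (at y)) (at (y + 0 *\<^sub>R axis i 1))"
      using that by (simp add: frechet_derivative_works)
    moreover have "((\<lambda>t. y + t *\<^sub>R axis i 1) has_derivative (\<lambda>t. t *\<^sub>R axis i (1::real))) (at 0)"
      by (auto intro!: derivative_eq_intros)
    ultimately have "((\<lambda>t. f (y + t *\<^sub>R axis i 1)) has_derivative
        (\<lambda>t. frechet_derivative f (at y) (t *\<^sub>R axis i 1))) (at 0)"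
      using has_derivative_compose[of "\<lambda>t. y + t *\<^sub>R axis i 1" _ 0 UNIV f] by simp
    moreover have "frechet_derivative f (at y) (t *\<^sub>R axis i 1) = t * partial_deriv i f y" for t
      using linear_frechet_derivative[OF that] by (simp add: linear_cmul partial_deriv_def)
    ultimately show ?thesis
      by (simp add: has_field_derivative_def mult.commute[of _ "partial_deriv i f y"] fun_eq_iff)
  qed
  from assms have d: "\<forall>x\<in>S. u differentiable (at x)"
    "\<forall>i. \<forall>x\<in>S. partial_deriv i u differentiable (at x)"
    by (auto simp: numeral_2_eq_2)
  show ?thesis
  proof (rule has_laplacian_onI[where g="\<lambda>i. partial_deriv i u"
        and g'="\<lambda>i. partial_deriv i (partial_deriv i u)"])
    show "continuous_on S u"
      using d by (auto intro!: continuous_at_imp_continuous_on differentiable_imp_continuous_within)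
  qed (use d in \<open>auto simp: laplacian_def intro!: *\<close>)
qed

section \<open>The maximum principle\<close>

text \<open>At the minimum \<open>f'\<close> vanishes; if \<open>c < 0\<close>, then
  \<open>f'\<close> is negative just to the right of 0, and the mean value theorem gives a smaller
  value of \<open>f\<close> there.\<close>

lemma second_derivative_nonneg_at_local_min:
  fixes f f' :: "real \<Rightarrow> real"
  assumes "e > 0" and f: "\<And>t. \<bar>t\<bar> < e \<Longrightarrow> (f has_real_derivative f' t) (at t)"
    and f': "(f' has_real_derivative c) (at 0)" and min: "\<And>t. \<bar>t\<bar> < e \<Longrightarrow> f 0 \<le> f t"
  shows "c \<ge> 0"
proof (rule ccontr)
  assume "\<not> c \<ge> 0"
  moreover have "f' 0 = 0"
    using DERIV_local_min[of f "f' 0" 0 e] assms by auto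
  ultimately obtain \<delta> where \<delta>: "\<delta> > 0" "\<And>t. 0 < t \<Longrightarrow> t < \<delta> \<Longrightarrow> f' t < 0"
    using DERIV_neg_dec_right[OF f'] by auto
  define s where "s = min \<delta> e / 2"
  have s: "0 < s" "s < \<delta>" "s < e" using \<delta> \<open>e > 0\<close> by (auto simp: s_def min_def)
  obtain \<xi> where "0 < \<xi>" "\<xi> < s" "f s - f 0 = (s - 0) * f' \<xi>"
    using MVT2[of 0 s f f'] f s by auto
  moreover from this s have "s * f' \<xi> < 0" by (intro mult_pos_neg \<delta>(2)) auto
  ultimately have "f s < f 0" by simp
  with min[of s] s show False by simp
qed

lemma laplacian_nonneg_at_local_min:
  assumes w: "has_laplacian_on w L S" and "open S" "z \<in> S"
    and min: "\<And>y. y \<in> S \<Longrightarrow> w z \<le> w y"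
  shows "L z \<ge> 0"
proof -
  from w obtain g g' where
    g': "\<And>y. y \<in> S \<Longrightarrow> (\<Sum>i\<in>UNIV. g' i y) = L y" and
    D: "\<And>y i. y \<in> S \<Longrightarrow> ((\<lambda>t. w (y + t *\<^sub>R axis i 1)) has_real_derivative g i y) (at 0)" and
    D2: "\<And>y i. y \<in> S \<Longrightarrow> ((\<lambda>t. g i (y + t *\<^sub>R axis i 1)) has_real_derivative g' i y) (at 0)"
    by (rule has_laplacian_onE) blast
  from \<open>open S\<close> \<open>z \<in> S\<close> obtain e where e: "e > 0" "ball z e \<subseteq> S"
    by (meson open_contains_ball)
  have "g' i z \<ge> 0" for i
  proof (rule second_derivative_nonneg_at_local_min[OF \<open>e > 0\<close>])
    fix t :: real assume "\<bar>t\<bar> < e"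
    then have t: "z + t *\<^sub>R axis i 1 \<in> S"
      using e by (auto simp: dist_norm subset_iff)
    show "w (z + 0 *\<^sub>R axis i 1) \<le> w (z + t *\<^sub>R axis i 1)"
      using min[OF t] by simp
    \<comment> \<open>The derivative at \<open>t\<close> on the line through \<open>z\<close> is the
      derivative at 0 on the same line based at the shifted point, where \<open>D\<close>
      applies.\<close>
    show "((\<lambda>t. w (z + t *\<^sub>R axis i 1)) has_real_derivative g i (z + t *\<^sub>R axis i 1)) (at t)"
      using D[OF t, of i] DERIV_shift[of "\<lambda>t. w (z + t *\<^sub>R axis i 1)" _ 0 t]
      by (simp add: algebra_simps)
  qed (rule D2[OF \<open>z \<in> S\<close>])
  then show ?thesis
    using g'[OF \<open>z \<in> S\<close>] by (metis sum_nonneg)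
qed

lemma minimum_principle:
  assumes w: "has_laplacian_on w L T" and "compact K" "K \<subseteq> T" "open S" "S \<subseteq> K"
    and neg: "\<And>z. z \<in> S \<Longrightarrow> L z < 0" and bd: "\<And>z. z \<in> K - S \<Longrightarrow> w z \<ge> 0" and "z \<in> K"
  shows "w z \<ge> 0"
proof -
  have "continuous_on K w"
    using w \<open>K \<subseteq> T\<close> by (auto simp: has_laplacian_on_def intro: continuous_on_subset)
  then obtain m where m: "m \<in> K" "\<And>y. y \<in> K \<Longrightarrow> w m \<le> w y"
    using continuous_attains_inf[of K w] \<open>compact K\<close> \<open>z \<in> K\<close> by blast
  have "m \<notin> S"
  proof
    assume "m \<in> S"
    then have "L m \<ge> 0"
      using laplacian_nonneg_at_local_min[of w L S m] has_laplacian_on_subset[OF w, of S] m assms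
      by blast
    with neg[OF \<open>m \<in> S\<close>] show False by simp
  qed
  with bd m \<open>z \<in> K\<close> show ?thesis by force
qed

section \<open>The barrier\<close>

text \<open>On the half cube of side \<open>d\<close> this is at least \<open>M\<close> on every face but \<open>z $ i = 0\<close>. On the
  \<open>i\<close>-axis it is \<open>O(z $ i)\<close>.\<close>

definition barrier :: "real \<Rightarrow> real \<Rightarrow> real \<Rightarrow> 'd \<Rightarrow> real^'d::finite \<Rightarrow> real" where
  "barrier M N d i z =
     M / d\<^sup>2 * ((\<Sum>j\<in>UNIV. (z $ j)\<^sup>2) - real CARD('d) * (z $ i)\<^sup>2 + real CARD('d) * d * z $ i)
     + N / 2 * (z $ i * (d - z $ i))"

text \<open>The part with factor \<open>M\<close> is harmonic: the sum of squares contributes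
  \<open>2 * CARD('d)\<close>, the term in \<open>(z $ i)\<^sup>2\<close> cancels it, and the rest
  is linear. The part with factor \<open>N\<close> contributes \<open>- N\<close>.\<close>

lemma has_laplacian_on_barrier:
  "has_laplacian_on (barrier M N d (i::'d::finite)) (\<lambda>_. - N) UNIV"
proof (rule has_laplacian_onI[where
      g="\<lambda>j z. M / d\<^sup>2 * (2 * z $ j + (if j = i then real CARD('d) * (d - 2 * z $ i) else 0))
               + (if j = i then N / 2 * (d - 2 * z $ i) else 0)"
      and g'="\<lambda>j z. M / d\<^sup>2 * (2 - (if j = i then 2 * real CARD('d) else 0)) - (if j = i then N else 0)"])
  show "continuous_on UNIV (barrier M N d i)"
    unfolding barrier_def by (intro continuous_intros)
next
  fix y :: "real^'d"
  show "(\<Sum>j\<in>UNIV. M / d\<^sup>2 * (2 - (if j = i then 2 * real CARD('d) else 0)) - (if j = i then N else 0)) = - N"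
  proof -
    have "(\<Sum>j\<in>UNIV. 2 - (if j = i then 2 * real CARD('d) else 0)) = 0"
      by (simp add: sum_subtractf)
    then show ?thesis
      by (simp only: sum_subtractf[of "\<lambda>j. M / d\<^sup>2 * _ j"] sum_distrib_left[symmetric]) simp
  qed
next
  fix y :: "real^'d" and j
  \<comment> \<open>Along an axis the sum of squares is an explicit quadratic polynomial in
    \<open>t\<close>, to which the differentiation rules apply.\<close>
  have "(\<Sum>k\<in>UNIV. ((y + t *\<^sub>R axis j 1) $ k)\<^sup>2) = (\<Sum>k\<in>UNIV. (y $ k)\<^sup>2) + 2 * t * y $ j + t\<^sup>2" for t
  proof -
    have "(\<Sum>k\<in>UNIV. ((y + t *\<^sub>R axis j 1) $ k)\<^sup>2)
        = (\<Sum>k\<in>UNIV. (y $ k)\<^sup>2 + (if k = j then 2 * t * y $ j + t\<^sup>2 else 0))"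
      by (rule sum.cong) (auto simp: axis_def power2_eq_square algebra_simps)
    then show ?thesis by (simp add: sum.distrib)
  qed
  then have "(\<lambda>t. barrier M N d i (y + t *\<^sub>R axis j 1)) = (\<lambda>t. M / d\<^sup>2 *
       ((\<Sum>k\<in>UNIV. (y $ k)\<^sup>2) + 2 * t * y $ j + t\<^sup>2
          - real CARD('d) * (y $ i + (if j = i then t else 0))\<^sup>2
          + real CARD('d) * d * (y $ i + (if j = i then t else 0)))
     + N / 2 * ((y $ i + (if j = i then t else 0)) * (d - (y $ i + (if j = i then t else 0)))))"
    by (auto simp: barrier_def axis_def fun_eq_iff)
  \<comment> \<open>\<open>M / d\<^sup>2\<close> does not depend on \<open>t\<close>; folded into
    \<open>c\<close> it is differentiated as a plain constant.\<close>
  moreover define c where "c = M / d\<^sup>2"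
  ultimately show "((\<lambda>t. barrier M N d i (y + t *\<^sub>R axis j 1)) has_real_derivative
      M / d\<^sup>2 * (2 * y $ j + (if j = i then real CARD('d) * (d - 2 * y $ i) else 0))
               + (if j = i then N / 2 * (d - 2 * y $ i) else 0)) (at 0)"
    unfolding c_def[symmetric]
    by (cases "j = i") (auto intro!: derivative_eq_intros simp: algebra_simps)
  show "((\<lambda>t. M / d\<^sup>2 * (2 * (y + t *\<^sub>R axis j 1) $ j
          + (if j = i then real CARD('d) * (d - 2 * (y + t *\<^sub>R axis j 1) $ i) else 0))
          + (if j = i then N / 2 * (d - 2 * (y + t *\<^sub>R axis j 1) $ i) else 0)) has_real_derivative
      M / d\<^sup>2 * (2 - (if j = i then 2 * real CARD('d) else 0)) - (if j = i then N else 0)) (at 0)"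
    unfolding c_def[symmetric]
    by (cases "j = i") (auto intro!: derivative_eq_intros simp: axis_def algebra_simps)
qed

text \<open>The two terms with factor \<open>CARD('d)\<close> combine to a multiple of
  \<open>z $ i * (d - z $ i)\<close>, which is nonnegative in the slab.\<close>

lemma barrier_nonneg:
  assumes "M \<ge> 0" "N \<ge> 0" "0 \<le> z $ i" "z $ i \<le> d"
  shows "barrier M N d i z \<ge> 0"
proof -
  have "0 \<le> real CARD('a) * (z $ i * (d - z $ i)) + (\<Sum>j\<in>UNIV. (z $ j)\<^sup>2)"
    using assms by (auto intro!: add_nonneg_nonneg sum_nonneg mult_nonneg_nonneg)
  then have "0 \<le> (\<Sum>j\<in>UNIV. (z $ j)\<^sup>2) - real CARD('a) * (z $ i)\<^sup>2 + real CARD('a) * d * z $ i"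
    by (simp add: algebra_simps power2_eq_square)
  then show ?thesis
    using assms unfolding barrier_def by simp
qed

text \<open>After the same regrouping, the single square \<open>(z $ j)\<^sup>2\<close> already
  contributes \<open>M / d\<^sup>2 * d\<^sup>2\<close>. The case \<open>j = i\<close> is the face
  opposite to the hyperplane.\<close>

lemma barrier_ge:
  assumes "M \<ge> 0" "N \<ge> 0" "d > 0" "0 \<le> z $ i" "z $ i \<le> d" "\<bar>z $ j\<bar> = d"
  shows "barrier M N d i z \<ge> M"
proof -
  have "d\<^sup>2 = (z $ j)\<^sup>2" using assms by (metis power2_abs)
  also have "\<dots> \<le> (\<Sum>j\<in>UNIV. (z $ j)\<^sup>2)" by (rule member_le_sum) auto
  finally have "d\<^sup>2 \<le> (\<Sum>j\<in>UNIV. (z $ j)\<^sup>2) + real CARD('a) * (z $ i * (d - z $ i))"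
    using assms by (simp add: add_increasing2)
  then have "M / d\<^sup>2 * d\<^sup>2 \<le> M / d\<^sup>2 * ((\<Sum>j\<in>UNIV. (z $ j)\<^sup>2) - real CARD('a) * (z $ i)\<^sup>2
      + real CARD('a) * d * z $ i)"
    using assms by (intro mult_left_mono) (auto simp: algebra_simps power2_eq_square)
  moreover have "0 \<le> N / 2 * (z $ i * (d - z $ i))" using assms by simp
  ultimately show ?thesis using \<open>d > 0\<close> by (simp add: barrier_def)
qed

text \<open>On the axis the barrier is a quadratic polynomial in \<open>h\<close> without constant
  term; its quadratic coefficient is nonpositive and is dropped.\<close>

lemma barrier_axis_le:
  assumes "M \<ge> 0" "N \<ge> 0" "d > 0" "h \<ge> 0"
  shows "barrier M N d (i::'d::finite) (h *\<^sub>R axis i 1) \<le> h * (real CARD('d) * M / d + N * d / 2)"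
proof -
  have "(\<Sum>j\<in>UNIV. ((h *\<^sub>R axis i 1 :: real^'d) $ j)\<^sup>2) = (\<Sum>j\<in>UNIV. if j = i then h\<^sup>2 else 0)"
    by (rule sum.cong) (auto simp: axis_def)
  then have "barrier M N d i (h *\<^sub>R axis i 1)
      = h * (real CARD('d) * M / d + N * d / 2) - (M / d\<^sup>2 * (real CARD('d) - 1) * h\<^sup>2 + N / 2 * h\<^sup>2)"
    using \<open>d > 0\<close> by (simp add: barrier_def field_simps power2_eq_square)
  moreover have "real CARD('d) \<ge> 1" by (simp add: Suc_leI)
  then have "0 \<le> M / d\<^sup>2 * (real CARD('d) - 1) * h\<^sup>2 + N / 2 * h\<^sup>2"
    using assms by (intro add_nonneg_nonneg mult_nonneg_nonneg) auto
  ultimately show ?thesis by linarith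
qed

section \<open>The gradient estimate\<close>

text \<open>Half the difference of \<open>u\<close> and its reflection vanishes on the hyperplane,
  is at most \<open>M\<close> in size, and has Laplacian smaller than \<open>N\<close> in size.
  Adding the barrier gives a function with negative Laplacian that is nonnegative on the boundary of
  the half cube, hence also at \<open>h *\<^sub>R axis i 1\<close>.\<close>

lemma odd_part_le_barrier:
  fixes u :: "real^'d::finite \<Rightarrow> real"
  assumes u: "has_laplacian_on u L (ball y \<rho>)"
    and M: "\<And>w. w \<in> ball y \<rho> \<Longrightarrow> \<bar>u w\<bar> \<le> M" and N: "\<And>w. w \<in> ball y \<rho> \<Longrightarrow> \<bar>L w\<bar> < N"
    and d: "0 < d" "real CARD('d) * d < \<rho>" and h: "0 \<le> h" "h \<le> d"
  shows "u (y - h *\<^sub>R axis i 1) - u (y + h *\<^sub>R axis i 1) \<le> 2 * barrier M N d i (h *\<^sub>R axis i 1)"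
proof -
  \<comment> \<open>The difference is written as a sum of scalar multiples to match the rules for
    \<open>has_laplacian_on\<close>.\<close>
  define w where "w z = barrier M N d i z + (1/2 * u (y + z) + (-1/2) * u (y + reflect i z))" for z
  define T where "T = {z. y + z \<in> ball y \<rho> \<and> y + reflect i z \<in> ball y \<rho>}"
  \<comment> \<open>\<open>K\<close> is the closed half cube and \<open>S\<close> its interior. The
    bound on \<open>CARD('d) * d\<close> keeps the full cube inside the ball, since the Euclidean
    norm is at most the sum of the coordinates in absolute value.\<close>
  define K where "K = cbox (\<chi> j. if j = i then 0 else - d) ((\<chi> j. d) :: real^'d)"
  define S where "S = box (\<chi> j. if j = i then 0 else - d) ((\<chi> j. d) :: real^'d)"
  have "\<rho> > 0" using d by (meson mult_nonneg_nonneg less_imp_le of_nat_0_le_iff le_less_trans)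
  then have "0 \<le> M" "0 \<le> N" using M[of y] N[of y] by auto
  have ball: "y + z \<in> ball y \<rho>" if "\<And>j. \<bar>z $ j\<bar> \<le> d" for z
  proof -
    have "norm z \<le> (\<Sum>j\<in>UNIV. \<bar>z $ j\<bar>)" by (rule norm_le_l1_cart)
    also have "\<dots> \<le> (\<Sum>j\<in>(UNIV::'d set). d)" using that by (intro sum_mono)
    finally show ?thesis using d by (simp add: dist_norm)
  qed
  have K: "0 \<le> z $ i" "z $ i \<le> d" "\<bar>z $ j\<bar> \<le> d" if "z \<in> K" for z j
    using that d by (auto simp: K_def mem_box_cart abs_le_iff dest: spec[of _ i] spec[of _ j] split: if_splits)
  have "K \<subseteq> T"
    using K by (auto simp: T_def reflect_nth simp del: mem_ball intro!: ball)
  have "h *\<^sub>R axis i 1 \<in> K"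
    using h d by (auto simp: K_def mem_box_cart axis_def)
  have lap: "has_laplacian_on w (\<lambda>z. - N + (1/2 * L (y + z) + (-1/2) * L (y + reflect i z))) T"
    unfolding w_def
    by (intro has_laplacian_on_add has_laplacian_on_cmult
          has_laplacian_on_subset[OF has_laplacian_on_barrier]
          has_laplacian_on_subset[OF has_laplacian_on_translate[OF u]]
          has_laplacian_on_subset[OF has_laplacian_on_reflect[OF has_laplacian_on_translate[OF u]]])
       (auto simp: T_def)
  have "w (h *\<^sub>R axis i 1) \<ge> 0"
  proof (rule minimum_principle[OF lap _ \<open>K \<subseteq> T\<close>])
    show "compact K" "open S" "S \<subseteq> K"
      by (auto simp: K_def S_def compact_cbox open_box box_subset_cbox)
    fix z assume "z \<in> S"
    with \<open>S \<subseteq> K\<close> \<open>K \<subseteq> T\<close> have "z \<in> T" by blast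
    then have "\<bar>L (y + z)\<bar> < N" "\<bar>L (y + reflect i z)\<bar> < N"
      by (auto simp: T_def simp del: mem_ball intro!: N)
    then show "- N + (1/2 * L (y + z) + (-1/2) * L (y + reflect i z)) < 0" by linarith
  next
    fix z assume z: "z \<in> K - S"
    then have "z \<in> T" using \<open>K \<subseteq> T\<close> by blast
    then have *: "\<bar>u (y + z)\<bar> \<le> M" "\<bar>u (y + reflect i z)\<bar> \<le> M"
      by (auto simp: T_def simp del: mem_ball intro!: M)
    show "w z \<ge> 0"
    proof (cases "z $ i = 0")
      case True
      \<comment> \<open>On the face in the hyperplane the two values of \<open>u\<close> cancel, so
        nonnegativity of the barrier suffices.\<close>
      then have "reflect i z = z" by (simp add: reflect_def)
      then show ?thesis
        using barrier_nonneg[of M N z i d] True \<open>0 \<le> M\<close> \<open>0 \<le> N\<close> \<open>0 < d\<close> by (simp add: w_def)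
    next
      case False
      \<comment> \<open>On every other face some coordinate has absolute value \<open>d\<close>, and
        there the barrier dominates the odd part.\<close>
      have "z \<in> K" "z \<notin> S" using z by auto
      from \<open>z \<notin> S\<close> obtain j where "\<not> ((if j = i then 0 else - d) < z $ j \<and> z $ j < d)"
        by (auto simp: S_def mem_box_cart)
      then have "\<bar>z $ j\<bar> = d"
        using K(1,2)[OF \<open>z \<in> K\<close>] K(3)[OF \<open>z \<in> K\<close>, of j] False by (auto split: if_splits)
      then have "barrier M N d i z \<ge> M"
        using barrier_ge[of M N d z i j] K[OF \<open>z \<in> K\<close>] \<open>0 \<le> M\<close> \<open>0 \<le> N\<close> \<open>0 < d\<close> by blast
      then show ?thesis using * by (simp add: w_def)
    qed
  qed fact
  moreover have "reflect i (h *\<^sub>R axis i 1) = - (h *\<^sub>R axis i 1)"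
    by (simp add: vec_eq_iff reflect_nth) (simp add: axis_def)
  ultimately show ?thesis by (simp add: w_def)
qed

text \<open>This is the slope of the barrier on the axis for
  \<open>d = \<rho> / (2 * CARD('d))\<close> and \<open>N = (\<bar>\<mu>\<bar> + 1) * M\<close>,
  with \<open>d\<^sup>2 / 2\<close> estimated by \<open>R\<^sup>2\<close> and the factor
  \<open>M / \<rho>\<close> removed. The \<open>itself\<close> argument only carries the
  dimension.\<close>

definition gradient_const :: "'d::finite itself \<Rightarrow> real \<Rightarrow> real \<Rightarrow> real" where
  "gradient_const _ \<mu> R = 2 * real CARD('d) * (real CARD('d) + (\<bar>\<mu>\<bar> + 1) * R\<^sup>2)"

lemma gradient_const_pos: "gradient_const TYPE('d::finite) \<mu> R > 0"
  by (auto simp: gradient_const_def intro!: mult_pos_pos add_pos_nonneg)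

text \<open>For \<open>h \<le> d\<close> the barrier estimate is applied to \<open>u\<close> and to
  its negative. For larger \<open>h\<close> the trivial bound \<open>2 * M\<close> is enough,
  because \<open>h / d > 1\<close>.\<close>

lemma central_difference_bound:
  fixes u :: "real^'d::finite \<Rightarrow> real"
  assumes u: "has_laplacian_on u (\<lambda>x. - \<mu> * u x) (ball y \<rho>)"
    and M: "\<And>w. w \<in> ball y \<rho> \<Longrightarrow> \<bar>u w\<bar> \<le> M" and "M > 0"
    and \<rho>: "0 < h" "h < \<rho>" "\<rho> \<le> R"
  shows "\<bar>u (y + h *\<^sub>R axis i 1) - u (y - h *\<^sub>R axis i 1)\<bar>
           \<le> 2 * h * (gradient_const TYPE('d) \<mu> R / \<rho> * M)"
proof -
  let ?n = "real CARD('d)" and ?C = "gradient_const TYPE('d) \<mu> R"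
  \<comment> \<open>The factor 2 gives \<open>CARD('d) * d = \<rho> / 2\<close>, so the cube fits
    strictly inside the ball.\<close>
  define d where "d = \<rho> / (2 * ?n)"
  have n: "?n \<ge> 1" by (simp add: Suc_leI)
  have d: "0 < d" "?n * d < \<rho>" "d \<le> R"
  proof -
    show "0 < d" using \<rho> n by (simp add: d_def)
    show "?n * d < \<rho>" using \<rho> n by (simp add: d_def)
    have "d \<le> ?n * d" using n \<open>0 < d\<close> by simp
    with \<open>?n * d < \<rho>\<close> \<rho> show "d \<le> R" by linarith
  qed
  have C: "?C / \<rho> * M = M / d * (?n + (\<bar>\<mu>\<bar> + 1) * R\<^sup>2)"
    using \<rho> n by (simp add: gradient_const_def d_def field_simps)
  show ?thesis
  proof (cases "h \<le> d")
    case True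
    \<comment> \<open>The summand 1 makes the bound on the Laplacian strict, as
      \<open>M > 0\<close>.\<close>
    define N where "N = (\<bar>\<mu>\<bar> + 1) * M"
    have N: "\<bar>- \<mu> * u w\<bar> < N" if "w \<in> ball y \<rho>" for w
    proof -
      have "\<bar>- \<mu> * u w\<bar> \<le> \<bar>\<mu>\<bar> * M"
        using M[OF that] by (simp add: abs_mult mult_left_mono)
      then show ?thesis using \<open>M > 0\<close> by (simp add: N_def algebra_simps)
    qed
    have "u (y - h *\<^sub>R axis i 1) - u (y + h *\<^sub>R axis i 1) \<le> 2 * barrier M N d i (h *\<^sub>R axis i 1)"
      by (rule odd_part_le_barrier[OF u M N]) (use True d \<rho> in auto)
    moreover have "has_laplacian_on (\<lambda>x. (-1) * u x) (\<lambda>x. (-1) * (- \<mu> * u x)) (ball y \<rho>)"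
      by (rule has_laplacian_on_cmult[OF u])
    from odd_part_le_barrier[OF this, of M N d h i]
    have "u (y + h *\<^sub>R axis i 1) - u (y - h *\<^sub>R axis i 1) \<le> 2 * barrier M N d i (h *\<^sub>R axis i 1)"
      using M N True d \<rho> by simp
    ultimately have "\<bar>u (y + h *\<^sub>R axis i 1) - u (y - h *\<^sub>R axis i 1)\<bar>
        \<le> 2 * barrier M N d i (h *\<^sub>R axis i 1)" by linarith
    also have "barrier M N d i (h *\<^sub>R axis i 1) \<le> h * (?n * M / d + N * d / 2)"
      by (rule barrier_axis_le) (use d \<rho> \<open>M > 0\<close> in \<open>auto simp: N_def\<close>)
    also have "?n * M / d + N * d / 2 = M / d * (?n + (\<bar>\<mu>\<bar> + 1) * (d\<^sup>2 / 2))"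
      using d by (simp add: N_def field_simps power2_eq_square)
    also have "\<dots> \<le> M / d * (?n + (\<bar>\<mu>\<bar> + 1) * R\<^sup>2)"
    proof -
      have "d\<^sup>2 \<le> R\<^sup>2" using d by (simp add: power_mono)
      moreover have "0 \<le> d\<^sup>2" by simp
      ultimately have "d\<^sup>2 / 2 \<le> R\<^sup>2" by linarith
      then show ?thesis using d \<open>M > 0\<close>
        by (intro mult_left_mono add_left_mono) auto
    qed
    finally show ?thesis using C \<rho> by (simp add: mult_left_mono)
  next
    case False
    have "\<bar>u (y + h *\<^sub>R axis i 1)\<bar> \<le> M" "\<bar>u (y - h *\<^sub>R axis i 1)\<bar> \<le> M"
      using \<rho> by (auto intro!: M simp: dist_norm)
    then have "\<bar>u (y + h *\<^sub>R axis i 1) - u (y - h *\<^sub>R axis i 1)\<bar> \<le> 2 * M" by linarith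
    also have "\<dots> \<le> 2 * h * (M / d)"
      using False d \<open>M > 0\<close> by (simp add: field_simps)
    also have "\<dots> \<le> 2 * h * (M / d * (?n + (\<bar>\<mu>\<bar> + 1) * R\<^sup>2))"
    proof -
      have "1 \<le> ?n + (\<bar>\<mu>\<bar> + 1) * R\<^sup>2" using n by (simp add: add_increasing2)
      then have "M / d * 1 \<le> M / d * (?n + (\<bar>\<mu>\<bar> + 1) * R\<^sup>2)"
        using d \<open>M > 0\<close> by (intro mult_left_mono) auto
      then show ?thesis using \<rho> by (intro mult_left_mono) auto
    qed
    finally show ?thesis using C by simp
  qed
qed

section \<open>Iteration\<close>

text \<open>Shifts are written on the left and the subtraction as a multiple by -1, the shapes of
  the rules for translates, multiples and sums.\<close>

definition central_quot :: "real \<Rightarrow> 'd::finite \<Rightarrow> (real^'d \<Rightarrow> real) \<Rightarrow> real^'d \<Rightarrow> real" where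
  "central_quot h i u x = 1 / (2 * h) * (u (h *\<^sub>R axis i 1 + x) + (-1) * u (- (h *\<^sub>R axis i 1) + x))"

lemma discrete_deriv_0: "discrete_deriv h 0 i u x = u x"
  by (simp add: discrete_deriv_def)

text \<open>The sum over sign vectors is split by the last sign: its two values form the central
  quotient in direction \<open>i k\<close>, and the remaining signs form the discrete derivative of
  order \<open>k\<close>.\<close>

lemma discrete_deriv_Suc:
  "discrete_deriv h (Suc k) i u x = discrete_deriv h k i (central_quot h (i k) u) x"
proof -
  let ?P = "{..<k} \<rightarrow>\<^sub>E {1, -1 :: real}"
  let ?F = "\<lambda>\<beta>. (\<Prod>j<Suc k. \<beta> j) * u (x + h *\<^sub>R (\<Sum>j<Suc k. \<beta> j *\<^sub>R axis (i j) 1))"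
  \<comment> \<open>Every sign vector of length \<open>Suc k\<close> is \<open>g(k := b)\<close> for
    exactly one pair, as \<open>k\<close> lies outside \<open>{..<k}\<close>.\<close>
  have "(\<Sum>\<beta>\<in>{..<Suc k} \<rightarrow>\<^sub>E {1, -1}. ?F \<beta>)
      = (\<Sum>\<beta>\<in>(\<lambda>(b, g). g(k := b)) ` ({1, -1} \<times> ?P). ?F \<beta>)"
    by (simp only: lessThan_Suc PiE_insert_eq)
  also have "\<dots> = (\<Sum>(b, g)\<in>{1, -1} \<times> ?P. ?F (g(k := b)))"
    by (subst sum.reindex[OF inj_combinator]) (auto simp: o_def case_prod_unfold)
  also have "\<dots> = (\<Sum>g\<in>?P. \<Sum>b\<in>{1, -1}. ?F (g(k := b)))"
    by (simp only: sum.cartesian_product[symmetric]) (rule sum.swap)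
  also have "\<dots> = (\<Sum>g\<in>?P. (\<Prod>j<k. g j) *
      (u (x + h *\<^sub>R (\<Sum>j<k. g j *\<^sub>R axis (i j) 1) + h *\<^sub>R axis (i k) 1)
       - u (x + h *\<^sub>R (\<Sum>j<k. g j *\<^sub>R axis (i j) 1) - h *\<^sub>R axis (i k) 1)))"
    by (rule sum.cong) (auto simp: algebra_simps)
  finally show ?thesis
    by (simp add: discrete_deriv_def central_quot_def sum_distrib_left algebra_simps)
qed

text \<open>Induction with \<open>u\<close> and \<open>M\<close> arbitrary: the central quotient
  solves the same linear, translation invariant equation on a ball smaller by \<open>\<rho>\<close>,
  and its bound grows by the one-step factor. Inserting \<open>x\<close> covers
  \<open>k = 0\<close>, where the ball is empty.\<close>

lemma discrete_deriv_bound: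
  fixes u :: "real^'d::finite \<Rightarrow> real"
  assumes "has_laplacian_on u (\<lambda>y. - \<mu> * u y) (ball x (real k * \<rho>))"
    and "\<And>w. w \<in> insert x (ball x (real k * \<rho>)) \<Longrightarrow> \<bar>u w\<bar> \<le> M" and "M > 0"
    and \<rho>: "0 < h" "h < \<rho>" "\<rho> \<le> R"
  shows "\<bar>discrete_deriv h k i u x\<bar> \<le> (gradient_const TYPE('d) \<mu> R / \<rho>) ^ k * M"
  using assms(1-3)
proof (induction k arbitrary: u M)
  case 0
  then show ?case by (simp add: discrete_deriv_0)
next
  case (Suc k)
  let ?C = "gradient_const TYPE('d) \<mu> R / \<rho>"
  let ?v = "central_quot h (i k) u"
  have C: "?C > 0" using gradient_const_pos[of \<mu> R, where 'd='d] \<rho> by simp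
  have near: "w \<in> ball x (real (Suc k) * \<rho>)"
    if "y \<in> insert x (ball x (real k * \<rho>))" "dist y w < \<rho>" for y w
  proof -
    have "dist x y \<le> real k * \<rho>" using that \<rho> by auto
    then show ?thesis using that(2) dist_triangle[of x w y] by (simp add: algebra_simps)
  qed
  have dist_shift: "dist y (v + y) = norm v" "dist y (y - v) = norm v" for y v :: "real^'d"
    by (simp_all add: dist_norm norm_minus_commute)
  have "\<bar>discrete_deriv h k i ?v x\<bar> \<le> ?C ^ k * (?C * M)"
  proof (rule Suc.IH)
    have "has_laplacian_on ?v (\<lambda>y. 1 / (2 * h) * (- \<mu> * u (h *\<^sub>R axis (i k) 1 + y)
        + (-1) * (- \<mu> * u (- (h *\<^sub>R axis (i k) 1) + y)))) (ball x (real k * \<rho>))"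
      unfolding central_quot_def[abs_def]
    proof (intro has_laplacian_on_cmult has_laplacian_on_add
        has_laplacian_on_subset[OF has_laplacian_on_translate[OF Suc.prems(1)]] subsetI CollectI)
      fix y assume "y \<in> ball x (real k * \<rho>)"
      then show "h *\<^sub>R axis (i k) 1 + y \<in> ball x (real (Suc k) * \<rho>)"
        "- (h *\<^sub>R axis (i k) 1) + y \<in> ball x (real (Suc k) * \<rho>)"
        using \<rho> by (auto intro!: near[of y] simp: dist_shift simp del: mem_ball of_nat_Suc)
    qed
    then show "has_laplacian_on ?v (\<lambda>y. - \<mu> * ?v y) (ball x (real k * \<rho>))"
      by (simp add: central_quot_def algebra_simps)
    show "\<bar>?v y\<bar> \<le> ?C * M" if y: "y \<in> insert x (ball x (real k * \<rho>))" for y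
    proof -
      have sub: "ball y \<rho> \<subseteq> ball x (real (Suc k) * \<rho>)"
        using near[OF y] by auto
      have "\<bar>u (y + h *\<^sub>R axis (i k) 1) - u (y - h *\<^sub>R axis (i k) 1)\<bar> \<le> 2 * h * (?C * M)"
        \<comment> \<open>The one-step estimate is used on \<open>ball y \<rho>\<close>, which lies
          in the larger ball; its factor \<open>2 * h\<close> cancels the denominator of the
          quotient.\<close>
        by (rule central_difference_bound[OF has_laplacian_on_subset[OF Suc.prems(1) sub]])
           (use sub Suc.prems \<rho> in blast)+
      then show ?thesis
        using \<rho> by (simp add: central_quot_def abs_mult field_simps)
    qed
    show "?C * M > 0" using C \<open>M > 0\<close> by (rule mult_pos_pos)
  qed
  then show ?case by (simp add: discrete_deriv_Suc mult_ac)
qed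

section \<open>Balls inside the domain and the final estimate\<close>

text \<open>A ball is connected, so if it met both \<open>S\<close> and its complement it would
  contain a frontier point, at distance less than \<open>r\<close> from \<open>x\<close>.\<close>

lemma ball_subset_of_infdist_frontier:
  fixes S :: "'a::euclidean_space set"
  assumes "x \<in> S" "r \<le> infdist x (frontier S)"
  shows "ball x r \<subseteq> S"
proof (rule ccontr)
  assume "\<not> ball x r \<subseteq> S"
  then obtain w where w: "w \<in> ball x r" "w \<notin> S" by blast
  then have "0 < r" using zero_le_dist[of x w] by (simp del: zero_le_dist)
  have "ball x r \<inter> frontier S \<noteq> {}"
  proof (rule connected_Int_frontier)
    show "ball x r \<inter> S \<noteq> {}" using assms(1) centre_in_ball[of x r] \<open>0 < r\<close> by blast
    show "ball x r - S \<noteq> {}" using w by auto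
  qed auto
  then obtain z where "z \<in> frontier S" "dist x z < r" by auto
  with infdist_le[of z "frontier S" x] assms show False by simp
qed

theorem theorem2p14:
  fixes \<Omega> :: "(real^'d::finite) set"
  assumes "CARD('d) \<ge> 2"
    and "open \<Omega>" and "bounded \<Omega>" and "connected \<Omega>" and "0 \<in> \<Omega>"
  shows "\<exists>C>0. \<forall>\<phi>. first_dirichlet_eigenfunction \<Omega> \<phi> \<longrightarrow>
    (\<forall>h>0. \<forall>k\<ge>1. \<forall>i :: nat \<Rightarrow> 'd. \<forall>x\<in>\<Omega>. infdist x (frontier \<Omega>) \<ge> 4 * real k * h \<longrightarrow>
      (\<forall>r\<in>{2 * real k * h <..< infdist x (frontier \<Omega>) / 2}.
        \<bar>discrete_deriv h k i \<phi> x\<bar> \<le> (C * real k / r) ^ k * (SUP w\<in>ball x r. \<bar>\<phi> w\<bar>)))"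
proof -
  \<comment> \<open>The constant has to be fixed before \<open>\<phi>\<close>. A smallest eigenvalue
    is unique, so the chosen one belongs to every admissible \<open>\<phi>\<close>; if none exists,
    the claim is vacuous.\<close>
  define \<mu> where "\<mu> = (SOME \<mu>. first_dirichlet_eigenvalue \<Omega> \<mu>)"
  have \<mu>: "\<nu> = \<mu>" if "first_dirichlet_eigenvalue \<Omega> \<nu>" for \<nu>
  proof -
    have "first_dirichlet_eigenvalue \<Omega> \<mu>" unfolding \<mu>_def using that by (rule someI)
    with that show ?thesis by (meson first_dirichlet_eigenvalue_def order_antisym)
  qed
  \<comment> \<open>Every ball inside the domain has radius at most \<open>R\<close>, which makes
    the constant independent of \<open>x\<close> and \<open>r\<close>.\<close>
  obtain R where R: "\<Omega> \<subseteq> ball 0 R" using \<open>bounded \<Omega>\<close> bounded_subset_ballD by blast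
  let ?C = "gradient_const TYPE('d) \<mu> R"
  have "\<bar>discrete_deriv h k i \<phi> x\<bar> \<le> (?C * real k / r) ^ k * (SUP w\<in>ball x r. \<bar>\<phi> w\<bar>)"
    if \<phi>: "first_dirichlet_eigenfunction \<Omega> \<phi>" and "h > 0" "k \<ge> 1" "x \<in> \<Omega>"
      and r: "r \<in> {2 * real k * h <..< infdist x (frontier \<Omega>) / 2}" for \<phi> h k i x r
  proof -
    from \<phi> obtain "C_on 2 \<Omega> \<phi>" "\<And>y. y \<in> \<Omega> \<Longrightarrow> laplacian \<phi> y = - \<mu> * \<phi> y"
      using \<mu> unfolding first_dirichlet_eigenfunction_def dirichlet_eigenfunction_def
      by (metis minus_mult_left minus_minus)
    then have lap: "has_laplacian_on \<phi> (\<lambda>y. - \<mu> * \<phi> y) \<Omega>"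
      using C_on_2_has_laplacian_on[of \<Omega> \<phi>] by (simp add: has_laplacian_on_def cong: ball_cong)
    have "0 < 2 * real k * h" using \<open>h > 0\<close> \<open>k \<ge> 1\<close> by simp
    with r have "0 < r" unfolding greaterThanLessThan_iff by linarith
    have sub: "cball x r \<subseteq> \<Omega>"
    proof -
      have "cball x r \<subseteq> ball x (2 * r)" using \<open>0 < r\<close> by auto
      with ball_subset_of_infdist_frontier[OF \<open>x \<in> \<Omega>\<close>, of "2 * r"] r show ?thesis by force
    qed
    have "r \<le> R"
    proof -
      have "cball x r \<subseteq> cball 0 R" using sub R by force
      then show ?thesis using \<open>0 < r\<close> by (simp add: cball_subset_cball_iff) (smt (verit) norm_ge_zero)
    qed
    \<comment> \<open>Compactness of the closed ball bounds \<open>\<phi>\<close>, so the supremum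
      over the open ball is a genuine upper bound.\<close>
    have "continuous_on (cball x r) (\<lambda>w. \<bar>\<phi> w\<bar>)"
      using lap sub by (auto simp: has_laplacian_on_def intro!: continuous_intros intro: continuous_on_subset)
    then have "bdd_above ((\<lambda>w. \<bar>\<phi> w\<bar>) ` cball x r)"
      by (intro bounded_imp_bdd_above compact_imp_bounded compact_continuous_image compact_cball)
    then have bdd: "bdd_above ((\<lambda>w. \<bar>\<phi> w\<bar>) ` ball x r)"
      by (rule bdd_above_mono) auto
    \<comment> \<open>With step length \<open>r / k\<close> the \<open>k\<close> steps use up
      exactly the radius \<open>r\<close>, and \<open>2 * k * h < r\<close> yields
      \<open>h < r / k\<close>.\<close>
    let ?M = "SUP w\<in>ball x r. \<bar>\<phi> w\<bar>" and ?\<rho> = "r / real k"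
    have M: "\<bar>\<phi> w\<bar> \<le> ?M" if "w \<in> ball x r" for w
      using bdd that by (intro cSUP_upper)
    have kr: "real k * ?\<rho> = r" using \<open>k \<ge> 1\<close> by simp
    have "\<bar>discrete_deriv h k i \<phi> x\<bar> \<le> (?C / ?\<rho>) ^ k * ?M"
    proof (rule discrete_deriv_bound, unfold kr)
      show "has_laplacian_on \<phi> (\<lambda>y. - \<mu> * \<phi> y) (ball x r)"
        using sub ball_subset_cball[of x r] by (intro has_laplacian_on_subset[OF lap]) blast
      show "\<bar>\<phi> w\<bar> \<le> ?M" if "w \<in> insert x (ball x r)" for w
        using that \<open>0 < r\<close> by (intro M) auto
      have "0 < \<bar>\<phi> x\<bar>" using \<phi> \<open>x \<in> \<Omega>\<close> by (auto simp: first_dirichlet_eigenfunction_def)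
      also have "\<dots> \<le> ?M" using \<open>0 < r\<close> by (intro M) auto
      finally show "0 < ?M" .
      have "h * real k < r" using r \<open>0 < 2 * real k * h\<close> by (simp add: mult.commute)
      then show "h < ?\<rho>" using \<open>k \<ge> 1\<close> by (simp add: field_simps)
      have "r * 1 \<le> R * real k" using \<open>r \<le> R\<close> \<open>0 < r\<close> \<open>k \<ge> 1\<close> by (intro mult_mono) auto
      then show "?\<rho> \<le> R" using \<open>k \<ge> 1\<close> by (simp add: field_simps)
    qed fact
    then show ?thesis by simp
  qed
  then show ?thesis using gradient_const_pos[of \<mu> R, where 'd='d] by blast
qed

end
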